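(* Let $[a_1,\ldots,a_n]$ be a positive continued fraction (all $a_i\in\mathbb{Z}_{\ge1}$), and write its value as a reduced fraction $p/q$ with $p,q$ positive coprime integers. For a graph $\mathcal{G}$ let $m(\mathcal{G})$ denote its number of perfect matchings. Then (a) $m(\mathcal{G}[a_1,\ldots,a_n])=p$; (b) $m(\mathcal{G}[a_2,\ldots,a_n])=q$; (c) $[a_1,\ldots,a_n]=\dfrac{m(\mathcal{G}[a_1,\ldots,a_n])}{m(\mathcal{G}[a_2,\ldots,a_n])}$ (and this fraction is reduced).
   Context: A tile is a unit square in the plane with sides parallel to the axes, regarded as a graph with 4 vertices and 4 edges. A snake graph is a planar graph consisting of tiles $G_1,\ldots,G_d$ ($d\ge1$) such that for each $i<d$, $G_i$ and $G_{i+1}$ share exactly one edge $e_i$, which is either the north edge of $G_i$ and south edge of $G_{i+1}$, or the east edge of $G_i$ and west edge of $G_{i+1}$; the single-edge graph is also a snake graph (0 tiles). $e_0$ is the south edge of $G_1$; the northeast edges are the north and east edges of $G_d$. A sign function is a map $f$ from edges to $\{+,-\}$ such that on each tile north and west edges have equal sign, south and east edges have equal sign, and north and south have opposite signs. A snake graph together with a choice $e_d$ of one of its northeast edges is determined by its sign sequence $(f(e_0),\ldots,f(e_d))$ up to global sign flip. For positive integers $a_1,\ldots,a_n$ with $d=a_1+\cdots+a_n-1$, $\mathcal{G}[a_1,\ldots,a_n]$ is the snake graph with $d$ tiles whose sign sequence (for suitable $e_d$) consists of $n$ consecutive constant blocks of lengths $a_1,\ldots,a_n$ with alternating signs; $\mathcal{G}[1]$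 is the single edge. A perfect matching is a set of edges such that every vertex lies in exactly one of them. *)

theory Defs
  imports Complex_Main
begin

text \<open>Value of \<open>[a\<^sub>1, \<dots>, a\<^sub>n]\<close>; the equation for the empty list is a dummy.\<close>

fun cf_value :: "nat list \<Rightarrow> rat" where
  "cf_value [] = 0"
| "cf_value [a] = of_nat a"
| "cf_value (a # b # as) = of_nat a + 1 / cf_value (b # as)"

type_synonym 'v graph = "'v set \<times> 'v set set"

definition perfect_matching :: "'v graph \<Rightarrow> 'v set set \<Rightarrow> bool" where
  "perfect_matching G M \<longleftrightarrow> M \<subseteq> snd G \<and> (\<forall>v\<in>fst G. \<exists>!e. e \<in> M \<and> v \<in> e)"

definition num_perfect_matchings :: "'v graph \<Rightarrow> nat" where
  "num_perfect_matchings G = card {M. perfect_matching G M}"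

type_synonym point = "int \<times> int"
type_synonym edge = "point set"

text \<open>A tile is represented by its lower left corner, a lattice point.\<close>

type_synonym tile = point

definition south :: "tile \<Rightarrow> edge" where
  "south = (\<lambda>(x, y). {(x, y), (x + 1, y)})"

definition north :: "tile \<Rightarrow> edge" where
  "north = (\<lambda>(x, y). {(x, y + 1), (x + 1, y + 1)})"

definition west :: "tile \<Rightarrow> edge" where
  "west = (\<lambda>(x, y). {(x, y), (x, y + 1)})"

definition east :: "tile \<Rightarrow> edge" where
  "east = (\<lambda>(x, y). {(x + 1, y), (x + 1, y + 1)})"

definition tile_verts :: "tile \<Rightarrow> point set" where
  "tile_verts = (\<lambda>(x, y). {(x, y), (x + 1, y), (x, y + 1), (x + 1, y + 1)})"

definition tile_edges :: "tile \<Rightarrow> edge set" where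
  "tile_edges T = {south T, north T, west T, east T}"

text \<open>The tile sequences \<open>G\<^sub>1, \<dots>, G\<^sub>d\<close> (\<open>d \<ge> 1\<close>) of snake graphs, listed from index \<open>0\<close>.\<close>

definition snake_tiles :: "tile list \<Rightarrow> bool" where
  "snake_tiles Ts \<longleftrightarrow> Ts \<noteq> [] \<and>
     (\<forall>i. Suc i < length Ts \<longrightarrow>
        (\<exists>e. tile_edges (Ts ! i) \<inter> tile_edges (Ts ! Suc i) = {e} \<and>
             (e = north (Ts ! i) \<and> e = south (Ts ! Suc i) \<or>
              e = east (Ts ! i) \<and> e = west (Ts ! Suc i))))"

definition tiles_graph :: "tile list \<Rightarrow> point graph" where
  "tiles_graph Ts = (\<Union>T\<in>set Ts. tile_verts T, \<Union>T\<in>set Ts. tile_edges T)"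

definition single_edge :: "point graph" where
  "single_edge = ({(0, 0), (1, 0)}, {{(0, 0), (1, 0)}})"

text \<open>Signs are encoded as booleans. Values of \<open>f\<close> off the edges of the graph are irrelevant.\<close>

definition sign_function :: "tile list \<Rightarrow> (edge \<Rightarrow> bool) \<Rightarrow> bool" where
  "sign_function Ts f \<longleftrightarrow>
     (\<forall>T\<in>set Ts. f (north T) = f (west T) \<and> f (south T) = f (east T) \<and> f (north T) \<noteq> f (south T))"

text \<open>\<open>es\<close> is the list \<open>e\<^sub>0, e\<^sub>1, \<dots>, e\<^sub>d\<close>, with \<open>e\<^sub>d\<close> one of the two northeast edges.\<close>

definition snake_edge_seq :: "tile list \<Rightarrow> edge list \<Rightarrow> bool" where
  "snake_edge_seq Ts es \<longleftrightarrow>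
     length es = length Ts + 1 \<and>
     es ! 0 = south (hd Ts) \<and>
     (\<forall>i. Suc i < length Ts \<longrightarrow>
        tile_edges (Ts ! i) \<inter> tile_edges (Ts ! Suc i) = {es ! Suc i}) \<and>
     es ! length Ts \<in> {north (last Ts), east (last Ts)}"

fun sign_blocks :: "bool \<Rightarrow> nat list \<Rightarrow> bool list" where
  "sign_blocks s [] = []"
| "sign_blocks s (a # as) = replicate a s @ sign_blocks (\<not> s) as"

definition realizes_cf :: "tile list \<Rightarrow> nat list \<Rightarrow> bool" where
  "realizes_cf Ts as \<longleftrightarrow>
     snake_tiles Ts \<and> length Ts + 1 = sum_list as \<and>
     (\<exists>f es s. sign_function Ts f \<and> snake_edge_seq Ts es \<and> map f es = sign_blocks s as)"

text \<open>
  The graph \<open>\<G>[a\<^sub>1, \<dots>, a\<^sub>n]\<close>. A snake graph is determined by its sign sequence only up to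
  translation, so the first tile is placed at the origin. The empty list arises from
  \<open>\<G>[a\<^sub>2, \<dots>, a\<^sub>n]\<close> with \<open>n = 1\<close>; by convention it denotes the single edge, in accordance
  with \<open>[a\<^sub>1] = [a\<^sub>1 - 1, 1]\<close> and \<open>\<G>[1]\<close> being the single edge.
\<close>

definition snake_graph :: "nat list \<Rightarrow> point graph" where
  "snake_graph as =
     (if as = [] \<or> as = [1] then single_edge
      else tiles_graph (THE Ts. realizes_cf Ts as \<and> hd Ts = (0, 0)))"

end

theory Submission
  imports Defs
begin

text \<open>
  For a snake graph with chosen northeast edge \<open>e\<^sub>d\<close> let \<open>m\<close> count its perfect matchings and
  \<open>k\<close> those containing \<open>e\<^sub>d\<close>. A perfect matching of the graph with one more tile glued along
  \<open>e\<^sub>d\<close> either contains the edge opposite to \<open>e\<^sub>d\<close>, and restricts to a perfect matching of the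
  old graph, or contains both edges adjacent to \<open>e\<^sub>d\<close>, and corresponds to an old matching
  containing \<open>e\<^sub>d\<close>. Hence \<open>(m, k)\<close> becomes \<open>(m + k, m)\<close> if the next edge is the opposite one,
  where the sign changes, and \<open>(m + k, k)\<close> if it is an adjacent one, where the sign stays the
  same. A block of \<open>a\<close> equal signs thus acts by \<open>(m, k) \<mapsto> (a m + k, m)\<close>, which is the
  recursion of the continuants.
\<close>

section \<open>Continuants\<close>

text \<open>Euler's continuants, the numerators of continued fractions. The value 1 on the empty
  list is the denominator of a one-term fraction.\<close>

fun continuant :: "nat list \<Rightarrow> nat" where
  "continuant [] = 1"
| "continuant [a] = a"
| "continuant (a # b # as) = a * continuant (b # as) + continuant as"

lemma continuant_Cons: "as \<noteq> [] \<Longrightarrow> continuant (a # as) = a * continuant as + continuant (tl as)"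
  by (cases as) auto

lemma continuant_pos: "\<forall>a\<in>set as. 1 \<le> a \<Longrightarrow> 0 < continuant as"
  by (induction as rule: continuant.induct) auto

text \<open>One step of Euclid's algorithm: dropping a multiple of the tail's continuant leaves the
  pair of the shorter list.\<close>

lemma coprime_continuant_tl: "as \<noteq> [] \<Longrightarrow> coprime (continuant as) (continuant (tl as))"
proof (induction as rule: continuant.induct)
  case (3 a b as)
  then have "gcd (continuant (b # as)) (a * continuant (b # as) + continuant as) = 1"
    by (simp only: gcd_add_mult) simp
  then show ?case
    by (simp add: coprime_iff_gcd_eq_1 gcd.commute)
qed auto

lemma cf_value_eq_continuant:
  "as \<noteq> [] \<Longrightarrow> \<forall>a\<in>set as. 1 \<le> a \<Longrightarrow>
    cf_value as = of_nat (continuant as) / of_nat (continuant (tl as))"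
proof (induction as rule: cf_value.induct)
  case (3 a b as)
  \<comment> \<open>The value of the tail is inverted, so its numerator has to be nonzero.\<close>
  have "0 < continuant (b # as)"
    using 3 by (intro continuant_pos) auto
  with 3 show ?case
    by (simp add: field_simps)
qed auto

section \<open>Matchings after gluing a tile onto an edge\<close>

definition matchings_with :: "'v graph \<Rightarrow> 'v set \<Rightarrow> 'v set set set" where
  "matchings_with G e = {M. perfect_matching G M \<and> e \<in> M}"

lemma finite_perfect_matchings: "finite (snd G) \<Longrightarrow> finite {M. perfect_matching G M}"
  by (rule finite_subset[of _ "Pow (snd G)"]) (auto simp: perfect_matching_def)

text \<open>The tile is reduced to its corners: \<open>u\<close>, \<open>v\<close> are old,
  \<open>u'\<close> and \<open>v'\<close> are their new neighbours. Without coordinates, gluing on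
  top and gluing on the right are instances of the same situation.\<close>

locale tile_gluing =
  fixes V :: "'v set" and E :: "'v set set" and u v u' v' :: 'v
  assumes edges_subset: "\<And>e. e \<in> E \<Longrightarrow> e \<subseteq> V"
    and finite_edges: "finite E"
    and glue_edge: "{u, v} \<in> E"
    and distinct: "u \<noteq> v" "u' \<noteq> v'"
    and fresh: "u' \<notin> V" "v' \<notin> V"
begin

abbreviation "G \<equiv> (V, E)"
abbreviation "G' \<equiv> (V \<union> {u', v'}, E \<union> {{u', v'}, {u, u'}, {v, v'}})"

lemma in_V: "u \<in> V" "v \<in> V"
  using edges_subset[OF glue_edge] by auto

lemma not_in_E: "{u', v'} \<notin> E" "{u, u'} \<notin> E" "{v, v'} \<notin> E"
  using edges_subset fresh by blast+

text \<open>Only \<open>{u', v'}\<close> and \<open>{u, u'}\<close> meet \<open>u'\<close>, and only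
  \<open>{u', v'}\<close> and \<open>{v, v'}\<close> meet \<open>v'\<close>. Exactly one edge of
  each pair is chosen, so the two sides are chosen together or not at all.\<close>

lemma matching_cases:
  assumes "perfect_matching G' M"
  shows "{u', v'} \<in> M \<and> {u, u'} \<notin> M \<and> {v, v'} \<notin> M \<or>
         {u', v'} \<notin> M \<and> {u, u'} \<in> M \<and> {v, v'} \<in> M"
proof -
  have sub: "M \<subseteq> E \<union> {{u', v'}, {u, u'}, {v, v'}}"
    and U: "\<exists>!e. e \<in> M \<and> u' \<in> e" and W: "\<exists>!e. e \<in> M \<and> v' \<in> e"
    using assms by (auto simp: perfect_matching_def)
  have ne: "{u', v'} \<noteq> {u, u'}" "{u', v'} \<noteq> {v, v'}"
    using in_V fresh by (auto simp: doubleton_eq_iff)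
  have "{u', v'} \<in> M \<or> {u, u'} \<in> M"
    using U sub edges_subset fresh distinct in_V by blast
  moreover have "{u', v'} \<in> M \<or> {v, v'} \<in> M"
    using W sub edges_subset fresh distinct in_V by blast
  moreover have "\<not> ({u', v'} \<in> M \<and> {u, u'} \<in> M)"
    using U ne by blast
  moreover have "\<not> ({u', v'} \<in> M \<and> {v, v'} \<in> M)"
    using W ne by blast
  ultimately show ?thesis by blast
qed

text \<open>The far edge covers precisely the two fresh vertices, so adding or removing it does not
  affect how vertices of \<open>V\<close> are covered.\<close>

lemma bij_far: "bij_betw (insert {u', v'}) {M. perfect_matching G M} (matchings_with G' {u', v'})"
proof (rule bij_betw_byWitness[where f' = "\<lambda>M. M - {{u', v'}}"])
  show "\<forall>M\<in>{M. perfect_matching G M}. insert {u', v'} M - {{u', v'}} = M"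
    using not_in_E by (auto simp: perfect_matching_def)
  show "\<forall>M\<in>matchings_with G' {u', v'}. insert {u', v'} (M - {{u', v'}}) = M"
    by (auto simp: matchings_with_def)
  show "insert {u', v'} ` {M. perfect_matching G M} \<subseteq> matchings_with G' {u', v'}"
  proof clarify
    fix M assume M: "perfect_matching G M"
    then have sub: "M \<subseteq> E" by (simp add: perfect_matching_def)
    have "\<exists>!e. e \<in> insert {u', v'} M \<and> w \<in> e" if w: "w \<in> V \<union> {u', v'}" for w
    proof (cases "w \<in> V")
      case True
      then have "w \<notin> {u', v'}" using fresh by auto
      moreover have "\<exists>!e. e \<in> M \<and> w \<in> e"
        using M True by (simp add: perfect_matching_def)
      ultimately show ?thesis by blast
    next
      case False
      then have "\<And>e. e \<in> M \<Longrightarrow> w \<notin> e" using sub edges_subset by blast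
      moreover have "w \<in> {u', v'}" using w False by blast
      ultimately show ?thesis by blast
    qed
    then show "insert {u', v'} M \<in> matchings_with G' {u', v'}"
      using sub by (auto simp: matchings_with_def perfect_matching_def)
  qed
  show "(\<lambda>M. M - {{u', v'}}) ` matchings_with G' {u', v'} \<subseteq> {M. perfect_matching G M}"
  proof clarify
    fix M assume "M \<in> matchings_with G' {u', v'}"
    then have M: "perfect_matching G' M" and far: "{u', v'} \<in> M"
      by (auto simp: matchings_with_def)
    have "M - {{u', v'}} \<subseteq> E"
      using matching_cases[OF M] far M by (auto simp: perfect_matching_def)
    moreover have "\<exists>!e. e \<in> M - {{u', v'}} \<and> w \<in> e" if w: "w \<in> V" for w
    proof -
      have "w \<notin> {u', v'}" using fresh w by auto
      moreover have "\<exists>!e. e \<in> M \<and> w \<in> e"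
        using M w by (simp add: perfect_matching_def)
      ultimately show ?thesis by blast
    qed
    ultimately show "perfect_matching G (M - {{u', v'}})"
      by (simp add: perfect_matching_def)
  qed
qed

text \<open>Trading \<open>{u, v}\<close> for the two sides keeps \<open>u\<close> and
  \<open>v\<close> covered and covers the fresh vertices as well; the inverse trades back.\<close>

lemma bij_sides:
  "bij_betw (\<lambda>M. (M - {{u, v}}) \<union> {{u, u'}, {v, v'}}) (matchings_with G {u, v})
     {M. perfect_matching G' M \<and> {u', v'} \<notin> M}"
proof (rule bij_betw_byWitness[where f' = "\<lambda>M. insert {u, v} (M - {{u, u'}, {v, v'}})"])
  have ne: "{u, v} \<noteq> {u, u'}" "{u, v} \<noteq> {v, v'}" "{u', v'} \<noteq> {u, u'}" "{u', v'} \<noteq> {v, v'}"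
    using in_V fresh by (auto simp: doubleton_eq_iff)
  show "\<forall>M\<in>matchings_with G {u, v}.
      insert {u, v} (((M - {{u, v}}) \<union> {{u, u'}, {v, v'}}) - {{u, u'}, {v, v'}}) = M"
    using not_in_E by (auto simp: matchings_with_def perfect_matching_def)
  \<comment> \<open>The inverse map inserts \<open>{u, v}\<close>, and deleting it again restores
    \<open>M\<close> only if it was absent. It is, since the side at \<open>u\<close> already covers
    \<open>u\<close>.\<close>
  have uv: "{u, v} \<notin> M" if M: "perfect_matching G' M" "{u', v'} \<notin> M" for M
  proof -
    have "{u, u'} \<in> M" using matching_cases[OF M(1)] M(2) by blast
    moreover have "\<exists>!e. e \<in> M \<and> u \<in> e"
      using M in_V by (simp add: perfect_matching_def)
    ultimately show ?thesis using ne by blast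
  qed
  show "\<forall>M\<in>{M. perfect_matching G' M \<and> {u', v'} \<notin> M}.
      (insert {u, v} (M - {{u, u'}, {v, v'}}) - {{u, v}}) \<union> {{u, u'}, {v, v'}} = M"
  proof clarify
    fix M assume "perfect_matching G' M" "{u', v'} \<notin> M"
    then show "(insert {u, v} (M - {{u, u'}, {v, v'}}) - {{u, v}}) \<union> {{u, u'}, {v, v'}} = M"
      using uv[of M] matching_cases[of M] by blast
  qed
  show "(\<lambda>M. (M - {{u, v}}) \<union> {{u, u'}, {v, v'}}) ` matchings_with G {u, v}
      \<subseteq> {M. perfect_matching G' M \<and> {u', v'} \<notin> M}"
  proof clarify
    fix M assume "M \<in> matchings_with G {u, v}"
    then have M: "perfect_matching G M" and near: "{u, v} \<in> M"
      by (auto simp: matchings_with_def)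
    then have sub: "M \<subseteq> E" by (simp add: perfect_matching_def)
    let ?M = "(M - {{u, v}}) \<union> {{u, u'}, {v, v'}}"
    have cover: "\<exists>!e. e \<in> M \<and> w \<in> e" if "w \<in> V" for w
      using M that by (simp add: perfect_matching_def)
    have "\<forall>w \<in> V \<union> {u', v'}. \<exists>!e. e \<in> ?M \<and> w \<in> e"
    proof
      fix w assume w: "w \<in> V \<union> {u', v'}"
      show "\<exists>!e. e \<in> ?M \<and> w \<in> e"
      proof (cases "w \<in> V")
        case V: True
        then have w': "w \<noteq> u'" "w \<noteq> v'" using fresh by auto
        show ?thesis
        proof (cases "w \<in> {u, v}")
          case True
          \<comment> \<open>At an end of the glued edge, \<open>M\<close> has no edge besides
            \<open>{u, v}\<close>, so after the exchange the side is the only one there.\<close>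
          then have "e \<notin> M - {{u, v}}" if "w \<in> e" for e
            using cover[OF V] near that by blast
          with True w' distinct(1) show ?thesis by blast
        next
          case False
          then show ?thesis using cover[OF V] w' by blast
        qed
      next
        case False
        then have "\<And>e. e \<in> M \<Longrightarrow> w \<notin> e" using sub edges_subset by blast
        moreover have "w \<in> {u', v'}" "w \<noteq> u" "w \<noteq> v" using w False in_V by auto
        ultimately show ?thesis using distinct(2) by blast
      qed
    qed
    moreover have "{u', v'} \<notin> ?M" using sub not_in_E ne by auto
    moreover have "?M \<subseteq> E \<union> {{u', v'}, {u, u'}, {v, v'}}" using sub by blast
    ultimately show "perfect_matching G' ?M \<and> {u', v'} \<notin> ?M"
      unfolding perfect_matching_def fst_conv snd_conv by (intro conjI)
  qed
  show "(\<lambda>M. insert {u, v} (M - {{u, u'}, {v, v'}})) ` {M. perfect_matching G' M \<and> {u', v'} \<notin> M}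
      \<subseteq> matchings_with G {u, v}"
  proof clarify
    fix M assume M: "perfect_matching G' M" and far: "{u', v'} \<notin> M"
    have sides: "{u, u'} \<in> M" "{v, v'} \<in> M" using matching_cases[OF M] far by auto
    let ?M = "insert {u, v} (M - {{u, u'}, {v, v'}})"
    have "?M \<subseteq> E"
      using M far glue_edge by (auto simp: perfect_matching_def)
    moreover have "\<exists>!e. e \<in> ?M \<and> w \<in> e" if w: "w \<in> V" for w
    proof -
      have cover: "\<exists>!e. e \<in> M \<and> w \<in> e"
        using M w by (simp add: perfect_matching_def)
      have w': "w \<noteq> u'" "w \<noteq> v'" using w fresh by auto
      show ?thesis
      proof (cases "w \<in> {u, v}")
        case True
        then have "e \<notin> M - {{u, u'}, {v, v'}}" if "w \<in> e" for e
          using cover sides that by blast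
        with True show ?thesis by blast
      next
        case False
        then show ?thesis using cover w' by blast
      qed
    qed
    ultimately show "?M \<in> matchings_with G {u, v}"
      by (simp add: perfect_matching_def matchings_with_def)
  qed
qed

lemma card_matchings_far: "card (matchings_with G' {u', v'}) = num_perfect_matchings G"
  using bij_betw_same_card[OF bij_far] by (simp add: num_perfect_matchings_def)

text \<open>By \<open>matching_cases\<close> the presence of either side alone is equivalent to the
  absence of the far edge.\<close>

lemma card_matchings_side:
  "card (matchings_with G' {u, u'}) = card (matchings_with G {u, v})"
  "card (matchings_with G' {v, v'}) = card (matchings_with G {u, v})"
proof -
  have "matchings_with G' {u, u'} = {M. perfect_matching G' M \<and> {u', v'} \<notin> M}"
    "matchings_with G' {v, v'} = {M. perfect_matching G' M \<and> {u', v'} \<notin> M}"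
    using matching_cases unfolding matchings_with_def by blast+
  then show "card (matchings_with G' {u, u'}) = card (matchings_with G {u, v})"
    "card (matchings_with G' {v, v'}) = card (matchings_with G {u, v})"
    using bij_betw_same_card[OF bij_sides] by simp_all
qed

lemma num_perfect_matchings_glue:
  "num_perfect_matchings G' = num_perfect_matchings G + card (matchings_with G {u, v})"
proof -
  have fin: "finite {M. perfect_matching G' M}"
    using finite_edges by (intro finite_perfect_matchings) simp
  have split: "{M. perfect_matching G' M} =
      matchings_with G' {u', v'} \<union> {M. perfect_matching G' M \<and> {u', v'} \<notin> M}"
    unfolding matchings_with_def by blast
  have "num_perfect_matchings G' =
      card (matchings_with G' {u', v'}) + card {M. perfect_matching G' M \<and> {u', v'} \<notin> M}"
    unfolding num_perfect_matchings_def split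
  proof (rule card_Un_disjoint)
    show "finite (matchings_with G' {u', v'})" "finite {M. perfect_matching G' M \<and> {u', v'} \<notin> M}"
      using finite_subset[OF _ fin] by (auto simp: matchings_with_def)
    show "matchings_with G' {u', v'} \<inter> {M. perfect_matching G' M \<and> {u', v'} \<notin> M} = {}"
      unfolding matchings_with_def by blast
  qed
  then show ?thesis
    using card_matchings_far bij_betw_same_card[OF bij_sides] by simp
qed

end

section \<open>Snake graphs as walks\<close>

definition up :: "tile \<Rightarrow> tile" where "up = (\<lambda>(x, y). (x, y + 1))"
definition right :: "tile \<Rightarrow> tile" where "right = (\<lambda>(x, y). (x + 1, y))"

lemmas tile_defs = south_def north_def west_def east_def tile_edges_def tile_verts_def
  up_def right_def

lemma south_up [simp]: "south (up T) = north T"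
  by (auto simp: tile_defs split: prod.splits)

lemma west_right [simp]: "west (right T) = east T"
  by (auto simp: tile_defs split: prod.splits)

lemma north_eq_south_iff: "north T = south T' \<longleftrightarrow> T' = up T"
  by (cases T; cases T') (auto simp: tile_defs doubleton_eq_iff)

lemma east_eq_west_iff: "east T = west T' \<longleftrightarrow> T' = right T"
  by (cases T; cases T') (auto simp: tile_defs doubleton_eq_iff)

lemma north_neq_east [simp]: "north T \<noteq> east T" "east T \<noteq> north T"
  by (cases T; auto simp: tile_defs doubleton_eq_iff)+

lemma tile_edges_up: "tile_edges T \<inter> tile_edges (up T) = {north T}"
  by (cases T) (auto simp: tile_defs doubleton_eq_iff)

lemma tile_edges_right: "tile_edges T \<inter> tile_edges (right T) = {east T}"
  by (cases T) (auto simp: tile_defs doubleton_eq_iff)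

text \<open>A shared edge pins down the lattice position of the next tile, which turns the condition
  in \<open>snake_tiles\<close> into a choice between two positions.\<close>

lemma common_edge_iff:
  "(\<exists>e. tile_edges T \<inter> tile_edges T' = {e} \<and>
      (e = north T \<and> e = south T' \<or> e = east T \<and> e = west T')) \<longleftrightarrow> T' = up T \<or> T' = right T"
  using tile_edges_up[of T] tile_edges_right[of T]
  by (auto simp: north_eq_south_iff east_eq_west_iff)

text \<open>Tiles and edges grow together at the northeast end, giving an induction that follows the
  gluing order. The chosen northeast edge of a prefix becomes the shared edge when a tile is
  appended.\<close>

inductive snake_walk :: "tile list \<Rightarrow> edge list \<Rightarrow> bool" where
  start: "e \<in> {north T, east T} \<Longrightarrow> snake_walk [T] [south T, e]"
| step: "snake_walk Ts es \<Longrightarrow>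
    last es = north (last Ts) \<and> T = up (last Ts) \<or> last es = east (last Ts) \<and> T = right (last Ts) \<Longrightarrow>
    e \<in> {north T, east T} \<Longrightarrow> snake_walk (Ts @ [T]) (es @ [e])"

lemma snake_tiles_snoc:
  assumes "Ts \<noteq> []"
  shows "snake_tiles (Ts @ [T]) \<longleftrightarrow> snake_tiles Ts \<and> (T = up (last Ts) \<or> T = right (last Ts))"
    (is "?l \<longleftrightarrow> ?r")
proof
  assume l: ?l
  have "Ts ! (length Ts - 1) = last Ts" using assms by (simp add: last_conv_nth)
  then have "T = up (last Ts) \<or> T = right (last Ts)"
    using l[unfolded snake_tiles_def common_edge_iff, THEN conjunct2, rule_format,
        of "length Ts - 1"] assms
    by (simp add: nth_append)
  moreover have "Ts ! Suc i = up (Ts ! i) \<or> Ts ! Suc i = right (Ts ! i)" if "Suc i < length Ts" for i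
    using l[unfolded snake_tiles_def common_edge_iff, THEN conjunct2, rule_format, of i] that
    by (simp add: nth_append)
  ultimately show ?r using assms by (simp add: snake_tiles_def common_edge_iff)
next
  assume r: ?r
  have "(Ts @ [T]) ! Suc i = up ((Ts @ [T]) ! i) \<or> (Ts @ [T]) ! Suc i = right ((Ts @ [T]) ! i)"
    if i: "Suc i < length (Ts @ [T])" for i
  proof (cases "Suc i < length Ts")
    case True
    then show ?thesis using r by (simp add: snake_tiles_def common_edge_iff nth_append)
  next
    case False
    then have "i = length Ts - 1" using i by simp
    then show ?thesis using r assms by (auto simp: nth_append last_conv_nth)
  qed
  then show ?l by (simp add: snake_tiles_def common_edge_iff)
qed

text \<open>Both directions compare a sequence with the one obtained by removing its last tile and
  last edge: the old \<open>e\<^sub>d\<close> is the edge shared with the removed tile.\<close>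

lemma snake_walk_iff: "snake_walk Ts es \<longleftrightarrow> snake_tiles Ts \<and> snake_edge_seq Ts es"
proof
  show "snake_walk Ts es \<Longrightarrow> snake_tiles Ts \<and> snake_edge_seq Ts es"
  proof (induction rule: snake_walk.induct)
    case (start e T)
    then show ?case by (auto simp: snake_tiles_def snake_edge_seq_def)
  next
    case (step Ts es T e)
    then have ne: "Ts \<noteq> []" and len: "length es = Suc (length Ts)"
      by (auto simp: snake_tiles_def snake_edge_seq_def)
    have "snake_tiles (Ts @ [T])" using step ne by (auto simp: snake_tiles_snoc)
    moreover have "tile_edges ((Ts @ [T]) ! i) \<inter> tile_edges ((Ts @ [T]) ! Suc i) = {(es @ [e]) ! Suc i}"
      if i: "Suc i < length (Ts @ [T])" for i
    proof (cases "Suc i < length Ts")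
      case True
      then show ?thesis using step len by (simp add: snake_edge_seq_def nth_append)
    next
      case False
      then have i: "i = length Ts - 1" "Suc i = length Ts" using i ne by auto
      have "es \<noteq> []" using len by auto
      then have "(es @ [e]) ! Suc i = last es" "(Ts @ [T]) ! i = last Ts" "(Ts @ [T]) ! Suc i = T"
        using i len ne by (simp_all add: nth_append last_conv_nth)
      then show ?thesis
        using step(2) tile_edges_up[of "last Ts"] tile_edges_right[of "last Ts"] by metis
    qed
    moreover have "(es @ [e]) ! 0 = south (hd (Ts @ [T]))"
      using step ne len by (simp add: snake_edge_seq_def nth_append)
    ultimately show ?case
      using len step by (simp add: snake_edge_seq_def nth_append)
  qed
  show "snake_tiles Ts \<and> snake_edge_seq Ts es \<Longrightarrow> snake_walk Ts es"
  proof (induction Ts arbitrary: es rule: rev_induct)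
    case Nil
    then show ?case by (simp add: snake_tiles_def)
  next
    case (snoc T Ts)
    then have es': "snake_edge_seq (Ts @ [T]) es" by simp
    then have "es \<noteq> []" by (auto simp: snake_edge_seq_def)
    then obtain es0 e where es: "es = es0 @ [e]" by (cases es rule: rev_cases) auto
    have len: "length es0 = Suc (length Ts)"
      using es' es by (simp add: snake_edge_seq_def)
    have e: "e \<in> {north T, east T}"
      using es' len by (simp add: snake_edge_seq_def es nth_append)
    show ?case
    proof (cases "Ts = []")
      case True
      then have "es0 = [south T]"
        using es' len by (cases es0) (auto simp: snake_edge_seq_def es)
      then show ?thesis using e True es by (auto intro: snake_walk.start)
    next
      case False
      have T: "snake_tiles Ts" "T = up (last Ts) \<or> T = right (last Ts)"
        using snoc.prems False by (auto simp: snake_tiles_snoc)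
      have common: "tile_edges ((Ts @ [T]) ! i) \<inter> tile_edges ((Ts @ [T]) ! Suc i) = {(es0 @ [e]) ! Suc i}"
        if "i < length Ts" for i
        using es' that by (auto simp: snake_edge_seq_def es)
      \<comment> \<open>There is one more edge than tiles, so this index is the last position of
        \<open>es0\<close>.\<close>
      have last: "es0 ! length Ts = last es0" using len
        by (metis diff_Suc_1 last_conv_nth length_0_conv nat.distinct(1))
      have "tile_edges (last Ts) \<inter> tile_edges T = {last es0}"
        using common[of "length Ts - 1"] False len last
        by (simp add: nth_append last_conv_nth)
      then have glue: "last es0 = north (last Ts) \<and> T = up (last Ts) \<or>
          last es0 = east (last Ts) \<and> T = right (last Ts)"
        using T(2) tile_edges_up[of "last Ts"] tile_edges_right[of "last Ts"] by auto
      have "tile_edges (Ts ! i) \<inter> tile_edges (Ts ! Suc i) = {es0 ! Suc i}"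
        if "Suc i < length Ts" for i
        using common[of i] that len by (simp add: nth_append)
      moreover have "es0 ! 0 = south (hd Ts)"
        using es' False len by (simp add: snake_edge_seq_def es nth_append)
      ultimately have "snake_edge_seq Ts es0"
        using len glue last by (auto simp: snake_edge_seq_def)
      then show ?thesis
        unfolding es using snoc.IH T(1) glue e by (intro snake_walk.step) auto
    qed
  qed
qed

lemma snake_walk_last: "snake_walk Ts es \<Longrightarrow> last es \<in> {north (last Ts), east (last Ts)}"
  by (induction rule: snake_walk.induct) auto

lemma snake_walk_ne: "snake_walk Ts es \<Longrightarrow> Ts \<noteq> [] \<and> es \<noteq> []"
  by (induction rule: snake_walk.induct) auto

lemma snake_walk_length: "snake_walk Ts es \<Longrightarrow> length es = Suc (length Ts)"
  by (induction rule: snake_walk.induct) auto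

lemma snake_walk_hd: "snake_walk Ts es \<Longrightarrow> hd es = south (hd Ts)"
  by (induction rule: snake_walk.induct) (auto simp: snake_walk_ne)

section \<open>The checkerboard sign function\<close>

text \<open>A single sign function for the whole lattice, given by orientation and the parity of the
  lower left endpoint. It restricts to every snake graph, so no signs have to be built along a
  walk.\<close>

definition edge_sign :: "edge \<Rightarrow> bool" where
  "edge_sign e \<longleftrightarrow> (\<exists>x y. e = {(x, y), (x + 1, y)} \<and> even (x + y) \<or> e = {(x, y), (x, y + 1)} \<and> odd (x + y))"

lemma edge_sign_horizontal: "edge_sign {(x, y), (x + 1, y)} \<longleftrightarrow> even (x + y)"
  by (auto simp: edge_sign_def doubleton_eq_iff)

lemma edge_sign_vertical: "edge_sign {(x, y), (x, y + 1)} \<longleftrightarrow> odd (x + y)"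
  by (auto simp: edge_sign_def doubleton_eq_iff)

text \<open>Passing from the south edge to the north edge changes the parity, to the west edge the
  orientation, and to the east edge both.\<close>

lemma edge_sign_tile [simp]:
  "edge_sign (west T) = (\<not> edge_sign (south T))"
  "edge_sign (north T) = (\<not> edge_sign (south T))"
  "edge_sign (east T) = edge_sign (south T)"
  by (cases T; simp add: tile_defs edge_sign_horizontal edge_sign_vertical;
      simp add: edge_sign_horizontal edge_sign_vertical add.assoc[symmetric])+

lemma edge_sign_origin [simp]: "edge_sign (south (0, 0))"
  using edge_sign_horizontal[of 0 0] by (simp add: south_def)

lemma sign_function_edge_sign: "sign_function Ts edge_sign"
  by (simp add: sign_function_def)

text \<open>One sign determines all signs on its tile, and consecutive tiles share an edge, so
  agreement or disagreement with \<open>edge_sign\<close> propagates along the walk.\<close>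

lemma sign_function_unique:
  assumes "snake_walk Ts es" "sign_function Ts f"
  shows "\<exists>c. \<forall>e\<in>set es. f e = (edge_sign e = c)"
  using assms
proof (induction rule: snake_walk.induct)
  case (start e T)
  \<comment> \<open>The witness records whether \<open>f\<close> agrees with
    \<open>edge_sign\<close> on the first edge; if not, \<open>f\<close> is the opposite function
    throughout.\<close>
  then show ?case
    by (intro exI[of _ "f (south T) = edge_sign (south T)"]) (auto simp: sign_function_def)
next
  case (step Ts es T e)
  then have "sign_function Ts f" unfolding sign_function_def by auto
  with step.IH obtain c where c: "\<forall>e\<in>set es. f e = (edge_sign e = c)" by blast
  have "last es \<in> set es" using snake_walk_ne[OF step(1)] by simp
  then have l: "f (last es) = (edge_sign (last es) = c)" using c by blast
  have T: "f (north T) = f (west T)" "f (south T) = f (east T)" "f (north T) \<noteq> f (south T)"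
    using step.prems by (auto simp: sign_function_def)
  have "last es = south T \<or> last es = west T" using step(2) by (metis south_up west_right)
  then have "f (south T) = (edge_sign (south T) = c)"
    using T l edge_sign_tile(1)[of T] by metis
  then have "f e = (edge_sign e = c)"
    using T step(3) edge_sign_tile[of T] by blast
  then show ?case using c by (intro exI[of _ c]) simp
qed

text \<open>The north and east edges of a tile have opposite signs, so a sign selects the exit edge,
  and the exit edge selects the next tile.\<close>

lemma snake_walk_unique:
  "snake_walk Ts es \<Longrightarrow> snake_walk Ts' es' \<Longrightarrow> hd Ts = hd Ts' \<Longrightarrow>
    map edge_sign es = map edge_sign es' \<Longrightarrow> Ts = Ts' \<and> es = es'"
proof (induction arbitrary: Ts' es' rule: snake_walk.induct)
  case (start e T)
  from start(2) show ?case
  proof cases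
    case (start e' T')
    then show ?thesis using \<open>e \<in> {north T, east T}\<close> \<open>hd [T] = hd Ts'\<close> \<open>map _ _ = _\<close> by auto
  next
    case (step Ts0 es0 T0 e0)
    \<comment> \<open>A one-tile walk has two edges, any longer walk at least three, so equal sign
      lists exclude this case.\<close>
    then have "length es0 = Suc (length Ts0)" "Ts0 \<noteq> []"
      using snake_walk_length snake_walk_ne by auto
    moreover have "length [south T, e] = length es'" using start.prems(3) map_eq_imp_length_eq by blast
    ultimately show ?thesis using step by simp
  qed
next
  case (step Ts es T e)
  note ne = snake_walk_ne[OF step(1)]
  from step(5) show ?case
  proof cases
    case (start e' T')
    have "length (es @ [e]) = length es'" using step.prems(3) map_eq_imp_length_eq by blast
    moreover have "length es = Suc (length Ts)" using snake_walk_length[OF step(1)] .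
    ultimately show ?thesis using ne start by simp
  next
    case (step Ts0 es0 T0 e0)
    have eq: "Ts = Ts0 \<and> es = es0"
    proof (rule \<open>\<And>Ts' es'. _ \<Longrightarrow> _ \<Longrightarrow> _ \<Longrightarrow> Ts = Ts' \<and> es = es'\<close>)
      show "snake_walk Ts0 es0" by fact
      show "hd Ts = hd Ts0"
        using step ne snake_walk_ne[of Ts0 es0] \<open>hd (Ts @ [T]) = hd Ts'\<close> by simp
      show "map edge_sign es = map edge_sign es0"
        using step \<open>map edge_sign (es @ [e]) = map edge_sign es'\<close> by simp
    qed
    have "T = T0"
      using eq step \<open>last es = _ \<and> _ \<or> _\<close> by auto
    moreover have "e = e0"
      using \<open>T = T0\<close> step \<open>e \<in> {north T, east T}\<close> \<open>map edge_sign (es @ [e]) = map edge_sign es'\<close> by auto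
    ultimately show ?thesis using eq step by simp
  qed
qed

text \<open>Either sign occurs among the northeast edges of any tile, so a walk can always be
  continued. The shortest walk, a single tile, already uses two signs.\<close>

lemma snake_walk_exists:
  assumes "2 \<le> length w" "hd w = edge_sign (south T)"
  shows "\<exists>Ts es. snake_walk Ts es \<and> hd Ts = T \<and> map edge_sign es = w"
  using assms
proof (induction w rule: rev_induct)
  case Nil
  then show ?case by simp
next
  case (snoc t w)
  have pick: "\<exists>e\<in>{north T', east T'}. edge_sign e = t" for T' by (cases t) auto
  show ?case
  proof (cases "2 \<le> length w")
    case True
    then have "hd w = edge_sign (south T)" using snoc.prems by (cases w) auto
    then obtain Ts es where W: "snake_walk Ts es" "hd Ts = T" "map edge_sign es = w"
      using snoc.IH True by blast
    obtain T' where T': "last es = north (last Ts) \<and> T' = up (last Ts) \<or>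
        last es = east (last Ts) \<and> T' = right (last Ts)"
      using snake_walk_last[OF W(1)] by blast
    obtain e where e: "e \<in> {north T', east T'}" "edge_sign e = t" using pick by blast
    have "snake_walk (Ts @ [T']) (es @ [e])" using W(1) T' e(1) by (rule snake_walk.step)
    moreover have "hd (Ts @ [T']) = T" using W snake_walk_ne[OF W(1)] by simp
    moreover have "map edge_sign (es @ [e]) = w @ [t]" using W e by simp
    ultimately show ?thesis by blast
  next
    case False
    with snoc.prems obtain s where w: "w = [s]" by (cases w; cases "tl w") auto
    obtain e where e: "e \<in> {north T, east T}" "edge_sign e = t" using pick by blast
    then have "snake_walk [T] [south T, e]" by (blast intro: snake_walk.start)
    moreover have "map edge_sign [south T, e] = w @ [t]" using w e snoc.prems by simp
    ultimately show ?thesis by (metis list.sel(1))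
  qed
qed

section \<open>Counting along a walk\<close>

text \<open>
  The state consists of the last sign, the number of matchings, and the number of those
  matchings that contain the last edge.
\<close>

definition count_step :: "bool \<Rightarrow> bool \<times> nat \<times> nat \<Rightarrow> bool \<times> nat \<times> nat" where
  "count_step t = (\<lambda>(s, m, k). (t, m + k, if t = s then k else m))"

lemma fold_count_replicate:
  "fold count_step (replicate a s) (s, m, k) = (s, m + a * k, k)"
  by (induction a arbitrary: m) (auto simp: count_step_def)

text \<open>The first sign of the block is a change and yields \<open>(m + k, m)\<close>; each of
  the remaining \<open>a - 1\<close> signs adds another \<open>m\<close> to the first count.\<close>

lemma fold_count_block:
  "0 < a \<Longrightarrow> fold count_step (replicate a s) (\<not> s, m, k) = (s, a * m + k, m)"
  by (cases a) (auto simp: count_step_def[of s] fold_count_replicate simp del: fold_replicate)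

text \<open>The count is linear in the initial pair. Keeping \<open>m\<close> and \<open>k\<close>
  arbitrary lets the induction restart from \<open>(a * m + k, m)\<close> after the first
  block.\<close>

lemma fold_count_sign_blocks:
  "as \<noteq> [] \<Longrightarrow> \<forall>a\<in>set as. 1 \<le> a \<Longrightarrow>
    fst (snd (fold count_step (sign_blocks s as) (\<not> s, m, k))) =
      continuant as * m + continuant (tl as) * k"
proof (induction as arbitrary: s m k)
  case (Cons a as)
  have a: "0 < a" using Cons.prems by auto
  show ?case
  proof (cases "as = []")
    case True
    then show ?thesis using fold_count_block[OF a] by simp
  next
    case False
    then show ?thesis
      using Cons.IH[of "\<not> s" "a * m + k" m] Cons.prems fold_count_block[OF a, of s m k]
      by (simp add: continuant_Cons algebra_simps)
  qed
qed simp

section \<open>Position of an appended tile and the effect of gluing it\<close>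

lemma edge_subset_tiles_graph:
  "e \<in> snd (tiles_graph Ts) \<Longrightarrow> e \<subseteq> fst (tiles_graph Ts)"
proof -
  have "e \<subseteq> tile_verts T" if "e \<in> tile_edges T" for T
    using that by (cases T) (auto simp: tile_defs)
  then show "e \<in> snd (tiles_graph Ts) \<Longrightarrow> e \<subseteq> fst (tiles_graph Ts)"
    unfolding tiles_graph_def by fastforce
qed

lemma finite_tiles_graph: "finite (snd (tiles_graph Ts))"
  by (auto simp: tiles_graph_def tile_edges_def)

text \<open>Steps go only up or right. This is what guarantees that the two outer corners of an
  appended tile are new.\<close>

lemma snake_walk_monotone:
  "snake_walk Ts es \<Longrightarrow> T \<in> set Ts \<Longrightarrow> fst T \<le> fst (last Ts) \<and> snd T \<le> snd (last Ts)"
proof (induction rule: snake_walk.induct)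
  case (step Ts es T' e)
  have "fst (last Ts) \<le> fst T' \<and> snd (last Ts) \<le> snd T'"
    using step(2) by (auto simp: up_def right_def split: prod.splits)
  then show ?case using step by fastforce
qed auto

lemma snake_walk_verts:
  assumes "snake_walk Ts es" "p \<in> fst (tiles_graph Ts)"
  shows "fst p \<le> fst (last Ts) + 1 \<and> snd p \<le> snd (last Ts) + 1"
proof -
  obtain T where "T \<in> set Ts" "p \<in> tile_verts T"
    using assms(2) by (auto simp: tiles_graph_def)
  then show ?thesis
    using snake_walk_monotone[OF assms(1), of T] by (cases T) (auto simp: tile_verts_def)
qed

text \<open>Here the far edge is north and the sides are west and east; the bound on
  \<open>V\<close> puts the two upper corners outside it.\<close>

lemma glue_south:
  assumes "\<And>e. e \<in> E \<Longrightarrow> e \<subseteq> V" "finite E" "south T \<in> E"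
    and fresh: "\<And>p. p \<in> V \<Longrightarrow> snd p \<le> snd T"
    and G': "G' = (V \<union> tile_verts T, E \<union> tile_edges T)"
  shows "num_perfect_matchings G' = num_perfect_matchings (V, E) + card (matchings_with (V, E) (south T))"
    and "card (matchings_with G' (north T)) = num_perfect_matchings (V, E)"
    and "card (matchings_with G' (east T)) = card (matchings_with (V, E) (south T))"
proof -
  obtain x y where T: "T = (x, y)" by (cases T)
  interpret tile_gluing V E "(x, y)" "(x + 1, y)" "(x, y + 1)" "(x + 1, y + 1)"
  proof
    show "\<And>e. e \<in> E \<Longrightarrow> e \<subseteq> V" by fact
    show "finite E" by fact
    show "{(x, y), (x + 1, y)} \<in> E" using assms(3) by (simp add: T south_def)
    show "(x, y + 1) \<notin> V" "(x + 1, y + 1) \<notin> V"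
      using fresh[of "(x, y + 1)"] fresh[of "(x + 1, y + 1)"] by (auto simp: T)
  qed simp_all
  have "V \<union> tile_verts T = V \<union> {(x, y + 1), (x + 1, y + 1)}"
    "E \<union> tile_edges T = E \<union> {north T, west T, east T}"
    using in_V assms(3) by (auto simp: tile_verts_def tile_edges_def T)
  then have G'_eq: "G' = (V \<union> {(x, y + 1), (x + 1, y + 1)}, E \<union>
      {{(x, y + 1), (x + 1, y + 1)}, {(x, y), (x, y + 1)}, {(x + 1, y), (x + 1, y + 1)}})"
    unfolding G' by (simp add: T north_def west_def east_def)
  have edges: "south T = {(x, y), (x + 1, y)}" "north T = {(x, y + 1), (x + 1, y + 1)}"
    "east T = {(x + 1, y), (x + 1, y + 1)}"
    by (simp_all add: T south_def north_def east_def)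
  show "num_perfect_matchings G' = num_perfect_matchings (V, E) + card (matchings_with (V, E) (south T))"
    unfolding G'_eq edges by (rule num_perfect_matchings_glue)
  show "card (matchings_with G' (north T)) = num_perfect_matchings (V, E)"
    unfolding G'_eq edges by (rule card_matchings_far)
  show "card (matchings_with G' (east T)) = card (matchings_with (V, E) (south T))"
    unfolding G'_eq edges by (rule card_matchings_side)
qed

text \<open>Mirror image of \<open>glue_south\<close> in the diagonal: the far edge is east, the
  sides are south and north.\<close>

lemma glue_west:
  assumes "\<And>e. e \<in> E \<Longrightarrow> e \<subseteq> V" "finite E" "west T \<in> E"
    and fresh: "\<And>p. p \<in> V \<Longrightarrow> fst p \<le> fst T"
    and G': "G' = (V \<union> tile_verts T, E \<union> tile_edges T)"
  shows "num_perfect_matchings G' = num_perfect_matchings (V, E) + card (matchings_with (V, E) (west T))"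
    and "card (matchings_with G' (east T)) = num_perfect_matchings (V, E)"
    and "card (matchings_with G' (north T)) = card (matchings_with (V, E) (west T))"
proof -
  obtain x y where T: "T = (x, y)" by (cases T)
  interpret tile_gluing V E "(x, y)" "(x, y + 1)" "(x + 1, y)" "(x + 1, y + 1)"
  proof
    show "\<And>e. e \<in> E \<Longrightarrow> e \<subseteq> V" by fact
    show "finite E" by fact
    show "{(x, y), (x, y + 1)} \<in> E" using assms(3) by (simp add: T west_def)
    show "(x + 1, y) \<notin> V" "(x + 1, y + 1) \<notin> V"
      using fresh[of "(x + 1, y)"] fresh[of "(x + 1, y + 1)"] by (auto simp: T)
  qed simp_all
  have "V \<union> tile_verts T = V \<union> {(x + 1, y), (x + 1, y + 1)}"
    "E \<union> tile_edges T = E \<union> {east T, south T, north T}"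
    using in_V assms(3) by (auto simp: tile_verts_def tile_edges_def T)
  then have G'_eq: "G' = (V \<union> {(x + 1, y), (x + 1, y + 1)}, E \<union>
      {{(x + 1, y), (x + 1, y + 1)}, {(x, y), (x + 1, y)}, {(x, y + 1), (x + 1, y + 1)}})"
    unfolding G' by (simp add: T north_def south_def east_def)
  have edges: "west T = {(x, y), (x, y + 1)}" "east T = {(x + 1, y), (x + 1, y + 1)}"
    "north T = {(x, y + 1), (x + 1, y + 1)}"
    by (simp_all add: T west_def north_def east_def)
  show "num_perfect_matchings G' = num_perfect_matchings (V, E) + card (matchings_with (V, E) (west T))"
    unfolding G'_eq edges by (rule num_perfect_matchings_glue)
  show "card (matchings_with G' (east T)) = num_perfect_matchings (V, E)"
    unfolding G'_eq edges by (rule card_matchings_far)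
  show "card (matchings_with G' (north T)) = card (matchings_with (V, E) (west T))"
    unfolding G'_eq edges by (rule card_matchings_side)
qed

lemma perfect_matching_edge: "perfect_matching ({u, v}, {{u, v}}) M \<longleftrightarrow> M = {{u, v}}"
proof
  assume M: "perfect_matching ({u, v}, {{u, v}}) M"
  then have "\<exists>e. e \<in> M \<and> u \<in> e" unfolding perfect_matching_def by auto
  moreover have "M \<subseteq> {{u, v}}" using M unfolding perfect_matching_def by simp
  ultimately show "M = {{u, v}}" by blast
qed (auto simp: perfect_matching_def)

lemma num_perfect_matchings_edge: "num_perfect_matchings ({u, v}, {{u, v}}) = 1"
  by (simp add: num_perfect_matchings_def perfect_matching_edge)

lemma card_matchings_with_edge: "card (matchings_with ({u, v}, {{u, v}}) {u, v}) = 1"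
proof -
  have "matchings_with ({u, v}, {{u, v}}) {u, v} = {{{u, v}}}"
    by (auto simp: matchings_with_def perfect_matching_edge)
  then show ?thesis by simp
qed

text \<open>The initial state is virtual: reading the sign of \<open>e\<^sub>0\<close> counts as a
  change and turns \<open>(1, 0)\<close> into \<open>(1, 1)\<close>, the correct counts for the
  single edge \<open>e\<^sub>0\<close>. From then on each sign glues one tile.\<close>

lemma fold_count_snake_walk:
  assumes "snake_walk Ts es"
  shows "fold count_step (map edge_sign es) (\<not> edge_sign (south (hd Ts)), 1, 0) =
    (edge_sign (last es), num_perfect_matchings (tiles_graph Ts),
     card (matchings_with (tiles_graph Ts) (last es)))"
  using assms
proof (induction rule: snake_walk.induct)
  case (start e T)
  obtain u v where uv: "south T = {u, v}" by (cases T) (auto simp: south_def)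
  have fresh: "\<And>p. p \<in> south T \<Longrightarrow> snd p \<le> snd T"
    by (auto simp: south_def split: prod.splits)
  \<comment> \<open>The first tile is also glued, onto the graph consisting of its south edge. An
    edge is the set of its ends, so \<open>south T\<close> serves as vertex set too.\<close>
  have G: "tiles_graph [T] = (south T \<union> tile_verts T, {south T} \<union> tile_edges T)"
    by (auto simp: tiles_graph_def tile_defs split: prod.splits)
  note glue = glue_south[OF _ _ _ fresh G, simplified]
  have "num_perfect_matchings (south T, {south T}) = 1"
    "card (matchings_with (south T, {south T}) (south T)) = 1"
    by (simp_all only: uv num_perfect_matchings_edge card_matchings_with_edge)
  then show ?case using start glue by (auto simp: count_step_def)
next
  case (step Ts es T e)
  define V E where "V = fst (tiles_graph Ts)" and "E = snd (tiles_graph Ts)"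
  have VE: "tiles_graph Ts = (V, E)" by (simp add: V_def E_def)
  note ne = snake_walk_ne[OF step(1)]
  have sub: "\<And>e. e \<in> E \<Longrightarrow> e \<subseteq> V" unfolding V_def E_def by (rule edge_subset_tiles_graph)
  have fin: "finite E" unfolding E_def by (rule finite_tiles_graph)
  have last: "tile_edges (last Ts) \<subseteq> E"
    using ne last_in_set by (fastforce simp: E_def tiles_graph_def)
  have G: "tiles_graph (Ts @ [T]) = (V \<union> tile_verts T, E \<union> tile_edges T)"
    by (auto simp: V_def E_def tiles_graph_def)
  have IH: "fold count_step (map edge_sign (es @ [e])) (\<not> edge_sign (south (hd (Ts @ [T]))), 1, 0) =
      count_step (edge_sign e) (edge_sign (last es), num_perfect_matchings (V, E),
        card (matchings_with (V, E) (last es)))"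
    using step.IH ne by (simp add: VE)
  from step(2) show ?case
  proof
    assume h: "last es = north (last Ts) \<and> T = up (last Ts)"
    have "\<And>p. p \<in> V \<Longrightarrow> snd p \<le> snd T"
      using snake_walk_verts[OF step(1)] h by (auto simp: V_def up_def split: prod.splits)
    moreover have "south T \<in> E" using h last by (auto simp: tile_edges_def)
    ultimately have "num_perfect_matchings (tiles_graph (Ts @ [T])) =
          num_perfect_matchings (V, E) + card (matchings_with (V, E) (south T))"
      "card (matchings_with (tiles_graph (Ts @ [T])) (north T)) = num_perfect_matchings (V, E)"
      "card (matchings_with (tiles_graph (Ts @ [T])) (east T)) = card (matchings_with (V, E) (south T))"
      using glue_south[OF sub fin _ _ G] by blast+
    moreover have "last es = south T" using h by simp
    ultimately show ?thesis
      unfolding IH using step(3) by (auto simp: count_step_def)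
  next
    assume h: "last es = east (last Ts) \<and> T = right (last Ts)"
    have "\<And>p. p \<in> V \<Longrightarrow> fst p \<le> fst T"
      using snake_walk_verts[OF step(1)] h by (auto simp: V_def right_def split: prod.splits)
    moreover have "west T \<in> E" using h last by (auto simp: tile_edges_def)
    ultimately have "num_perfect_matchings (tiles_graph (Ts @ [T])) =
          num_perfect_matchings (V, E) + card (matchings_with (V, E) (west T))"
      "card (matchings_with (tiles_graph (Ts @ [T])) (east T)) = num_perfect_matchings (V, E)"
      "card (matchings_with (tiles_graph (Ts @ [T])) (north T)) = card (matchings_with (V, E) (west T))"
      using glue_west[OF sub fin _ _ G] by blast+
    \<comment> \<open>Measured against the west edge, east is opposite and changes the sign, while
      north is adjacent and keeps it.\<close>
    moreover have "last es = west T" using h by simp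
    ultimately show ?thesis
      unfolding IH using step(3) by (auto simp: count_step_def)
  qed
qed

section \<open>The snake graph of a continued fraction\<close>

lemma length_sign_blocks [simp]: "length (sign_blocks s as) = sum_list as"
  by (induction as arbitrary: s) auto

lemma map_Not_sign_blocks: "map Not (sign_blocks s as) = sign_blocks (\<not> s) as"
  by (induction as arbitrary: s) auto

lemma hd_sign_blocks: "as \<noteq> [] \<Longrightarrow> \<forall>a\<in>set as. 1 \<le> a \<Longrightarrow> hd (sign_blocks s as) = s"
  by (cases as; cases "hd as") auto

text \<open>Placing the first tile at the origin makes the sign of \<open>e\<^sub>0\<close> under
  \<open>edge_sign\<close> true, which removes the freedom of a global sign flip.\<close>

lemma realizes_cf_iff:
  assumes "as \<noteq> []" "\<forall>a\<in>set as. 1 \<le> a" "hd Ts = (0, 0)"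
  shows "realizes_cf Ts as \<longleftrightarrow> (\<exists>es. snake_walk Ts es \<and> map edge_sign es = sign_blocks True as)"
proof
  assume "realizes_cf Ts as"
  then obtain f es s where *: "snake_walk Ts es" "sign_function Ts f" "map f es = sign_blocks s as"
    by (auto simp: realizes_cf_def snake_walk_iff)
  obtain c where c: "\<forall>e\<in>set es. f e = (edge_sign e = c)"
    using sign_function_unique[OF *(1,2)] by blast
  \<comment> \<open>Comparing with \<open>c\<close> is the identity or negation, and negation only
    swaps the starting sign of the blocks.\<close>
  have "map edge_sign es = map (\<lambda>b. b = c) (map f es)"
    using c by auto
  also have "\<dots> = sign_blocks (s = c) as"
    using map_Not_sign_blocks[of s as] by (cases c) (simp_all add: *(3))
  finally have es: "map edge_sign es = sign_blocks (s = c) as" .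
  have "hd (map edge_sign es) = True"
    using snake_walk_hd[OF *(1)] snake_walk_ne[OF *(1)] assms(3) by (simp add: hd_map)
  then have "(s = c) = True" using hd_sign_blocks[OF assms(1,2)] es by metis
  then show "\<exists>es. snake_walk Ts es \<and> map edge_sign es = sign_blocks True as"
    using es *(1) by auto
next
  assume "\<exists>es. snake_walk Ts es \<and> map edge_sign es = sign_blocks True as"
  then obtain es where es: "snake_walk Ts es" "map edge_sign es = sign_blocks True as" by blast
  have "length es = sum_list as" using es(2) by (metis length_map length_sign_blocks)
  then have "length Ts + 1 = sum_list as" using snake_walk_length[OF es(1)] by simp
  then show "realizes_cf Ts as"
    using es sign_function_edge_sign unfolding realizes_cf_def snake_walk_iff by blast
qed

text \<open>The two excluded lists are those standing for the single edge; every other list needs at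
  least one tile.\<close>

lemma sum_list_ge_2:
  fixes as :: "nat list"
  assumes "as \<noteq> []" "as \<noteq> [1]" "\<forall>a\<in>set as. 1 \<le> a"
  shows "2 \<le> sum_list as"
proof (cases as)
  case (Cons a bs)
  show ?thesis
  proof (cases bs)
    case Nil
    then show ?thesis using Cons assms by auto
  next
    case (Cons b cs)
    then show ?thesis using \<open>as = a # bs\<close> assms by auto
  qed
qed (use assms in simp)

lemma num_perfect_matchings_snake_graph:
  assumes pos: "\<forall>a\<in>set as. 1 \<le> a"
  shows "num_perfect_matchings (snake_graph as) = continuant as"
proof (cases "as = [] \<or> as = [1]")
  case True
  \<comment> \<open>Both conventional cases have continuant 1, matching the unique perfect matching
    of an edge.\<close>
  then show ?thesis
    by (auto simp: snake_graph_def single_edge_def num_perfect_matchings_edge[simplified])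
next
  case False
  then have ne: "as \<noteq> []" by blast
  have "2 \<le> length (sign_blocks True as)"
    using sum_list_ge_2 False pos by simp
  then obtain Ts es where W: "snake_walk Ts es" "hd Ts = (0, 0)" "map edge_sign es = sign_blocks True as"
    using snake_walk_exists[of "sign_blocks True as" "(0, 0)"] hd_sign_blocks[OF ne pos] by auto
  \<comment> \<open>The description is resolved by existence and uniqueness of the walk with the
    given signs.\<close>
  have "(THE Ts. realizes_cf Ts as \<and> hd Ts = (0, 0)) = Ts"
  proof (rule the_equality)
    show "realizes_cf Ts as \<and> hd Ts = (0, 0)" using W realizes_cf_iff[OF ne pos] by blast
    fix Ts' assume "realizes_cf Ts' as \<and> hd Ts' = (0, 0)"
    then obtain es' where "snake_walk Ts' es'" "hd Ts' = (0, 0)" "map edge_sign es' = sign_blocks True as"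
      using realizes_cf_iff[OF ne pos] by blast
    then show "Ts' = Ts" using snake_walk_unique W by metis
  qed
  then have "snake_graph as = tiles_graph Ts" using False by (simp add: snake_graph_def)
  \<comment> \<open>For the initial pair \<open>(1, 0)\<close> the linear formula reduces to
    \<open>continuant as\<close>.\<close>
  then show ?thesis
    using fold_count_snake_walk[OF W(1)] fold_count_sign_blocks[OF ne pos, of True 1 0] W
    by simp
qed

theorem theorem3p4:
  fixes as :: "nat list" and p q :: nat
  assumes "as \<noteq> []"
    and "\<forall>a\<in>set as. a \<ge> 1"
    and "p > 0" and "q > 0" and "coprime p q"
    and "cf_value as = of_nat p / of_nat q"
  shows "num_perfect_matchings (snake_graph as) = p
    \<and> num_perfect_matchings (snake_graph (tl as)) = q
    \<and> cf_value as = of_nat (num_perfect_matchings (snake_graph as))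
                    / of_nat (num_perfect_matchings (snake_graph (tl as)))
    \<and> coprime (num_perfect_matchings (snake_graph as))
               (num_perfect_matchings (snake_graph (tl as)))"
proof -
  let ?m = "continuant as" and ?k = "continuant (tl as)"
  have pos_tl: "\<forall>a\<in>set (tl as). 1 \<le> a"
    using assms(2) by (meson list.set_sel(2) assms(1))
  have k: "0 < ?k" using pos_tl by (rule continuant_pos)
  have cop: "coprime ?m ?k" using assms(1) by (rule coprime_continuant_tl)
  have val: "cf_value as = of_nat ?m / of_nat ?k"
    using assms(1,2) by (rule cf_value_eq_continuant)
  have "(of_nat p :: rat) * of_nat ?k = of_nat ?m * of_nat q"
    using assms(4,6) val k by (simp add: field_simps)
  then have cross: "p * ?k = ?m * q" by (metis of_nat_eq_iff of_nat_mult)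
  \<comment> \<open>Two reduced fractions with equal cross products have the same numerator and the
    same denominator.\<close>
  have "p = ?m \<and> ?k = q"
    using coprime_crossproduct_nat[of p q ?m ?k] cross assms(5) cop by (simp add: ac_simps)
  then show ?thesis
    using val cop num_perfect_matchings_snake_graph[OF assms(2)]
      num_perfect_matchings_snake_graph[OF pos_tl] by simp
qed

end
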